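(* Let $X$ be a proper CAT(0) space with basepoint $x_0$, let $\omega$ be a non-principal ultrafilter on $\mathbb N$, let $(\alpha_n)_{n\in\mathbb N}$ be a sequence in $\partial X$ and let $\alpha_0\in\partial X$. Then $\alpha_n$ converges to $\alpha_0$ in the visual boundary $\partial_\infty X$ if and only if for every bijection $\sigma:\mathbb N\to\mathbb N$ there exists a scaling sequence $d$ such that $\Psi^\omega_d\bigl(t,(\alpha_{\sigma(n)})\bigr)=\Psi_d(t,\alpha_0)$ for all $t\geq 0$.
   Context: A metric space is proper if closed balls are compact. Fix $x_0\in X$. $\partial X$ is the set of geodesic rays $\alpha:[0,\infty)\to X$ with $\alpha(0)=x_0$. The visual boundary $\partial_\infty X$ is $\partial X$ with the topology with basis $U(\alpha,R,\epsilon)=\{\beta\in\partial X\mid \mathrm{dist}(\alpha(R),\mathrm{im}(\beta))<\epsilon\}$, $\alpha\in\partial X$, $R,\epsilon>0$. $\omega$ is a non-principal ultrafilter on $\mathbb N$ and $\lim^\omega$ denotes the ultralimit. A scaling sequence is a sequence $d=(d_n)$ of positive reals with $\lim^\omega d_n=\infty$. The asymptotic cone $\mathrm{Con}^\omega(X,(x_0),d)$ is the set of sequences $(x_n)$ in $X$ with $\mathrm{dist}(x_n,x_0)/d_n$ bounded, modulo $(x_n)\sim(y_n)$ if $\lim^\omega \mathrm{dist}(x_n,y_n)/d_n=0$, with metric $\lim^\omega\mathrm{dist}(x_n,y_n)/d_n$. For a sequence $(\beta_n)$ in $\partial X$, $\beta\in\partial X$ and $t\ge0$, $\Psi^\omega_d(t,(\beta_n))=(\beta_n(td_n))$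 and $\Psi_d(t,\beta)=(\beta(td_n))$, as points of $\mathrm{Con}^\omega(X,(x_0),d)$. *)

theory Defs
  imports "HOL-Analysis.Analysis"
begin

definition proper :: "'a::metric_space itself \<Rightarrow> bool" where
  "proper _ \<longleftrightarrow> (\<forall>(x::'a) r. compact (cball x r))"

definition geodesic_segment :: "'a::metric_space \<Rightarrow> 'a \<Rightarrow> 'a set \<Rightarrow> bool" where
  "geodesic_segment p q S \<longleftrightarrow>
    (\<exists>c::real \<Rightarrow> 'a. c 0 = p \<and> c (dist p q) = q \<and>
      (\<forall>s\<in>{0..dist p q}. \<forall>t\<in>{0..dist p q}. dist (c s) (c t) = \<bar>s - t\<bar>) \<and>
      S = c ` {0..dist p q})"

definition geodesic_space :: "'a::metric_space itself \<Rightarrow> bool" where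
  "geodesic_space _ \<longleftrightarrow> (\<forall>p q::'a. \<exists>S. geodesic_segment p q S)"

definition comparison_point ::
  "'a::metric_space \<Rightarrow> 'a set \<Rightarrow> real^2 \<Rightarrow> real^2 \<Rightarrow> 'a \<Rightarrow> real^2 \<Rightarrow> bool" where
  "comparison_point p S p' q' x x' \<longleftrightarrow>
    x \<in> S \<and> x' \<in> closed_segment p' q' \<and> dist p' x' = dist p x"

text \<open>
  Geodesic triangles have sides \<open>S\<^sub>1\<close>, \<open>S\<^sub>2\<close>, \<open>S\<^sub>3\<close> joining \<open>p\<close> to \<open>q\<close>, \<open>q\<close> to \<open>r\<close> and \<open>r\<close> to \<open>p\<close>;
  \<open>p'\<close>, \<open>q'\<close>, \<open>r'\<close> are the vertices of a comparison triangle in the Euclidean plane.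
\<close>

definition CAT0 :: "'a::metric_space itself \<Rightarrow> bool" where
  "CAT0 T \<longleftrightarrow> geodesic_space T \<and>
    (\<forall>(p::'a) q r S\<^sub>1 S\<^sub>2 S\<^sub>3 p' q' r'.
      geodesic_segment p q S\<^sub>1 \<and> geodesic_segment q r S\<^sub>2 \<and> geodesic_segment r p S\<^sub>3 \<and>
      dist p' q' = dist p q \<and> dist q' r' = dist q r \<and> dist r' p' = dist r p \<longrightarrow>
      (let comparison = (\<lambda>x x'. comparison_point p S\<^sub>1 p' q' x x' \<or>
             comparison_point q S\<^sub>2 q' r' x x' \<or> comparison_point r S\<^sub>3 r' p' x x')
       in \<forall>x y x' y'. comparison x x' \<and> comparison y y' \<longrightarrow> dist x y \<le> dist x' y'))"

text \<open>
  Rays are functions on \<open>[0,\<infinity>)\<close>; extensionality fixes their values at negative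
  arguments, so that equality of functions is equality of rays.
\<close>

definition rays :: "'a::metric_space \<Rightarrow> (real \<Rightarrow> 'a) set" where
  "rays x\<^sub>0 = {\<alpha> \<in> extensional {0..}. \<alpha> 0 = x\<^sub>0 \<and>
    (\<forall>s\<in>{0..}. \<forall>t\<in>{0..}. dist (\<alpha> s) (\<alpha> t) = \<bar>s - t\<bar>)}"

definition boundary_nbhd ::
  "'a::metric_space \<Rightarrow> (real \<Rightarrow> 'a) \<Rightarrow> real \<Rightarrow> real \<Rightarrow> (real \<Rightarrow> 'a) set" where
  "boundary_nbhd x\<^sub>0 \<alpha> R \<epsilon> = {\<beta> \<in> rays x\<^sub>0. infdist (\<alpha> R) (\<beta> ` {0..}) < \<epsilon>}"

text \<open>
  In a CAT(0) space the sets \<^const>\<open>boundary_nbhd\<close> form a basis, and then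
  the topology they generate is the one having them as a basis.
\<close>

definition visual_boundary :: "'a::metric_space \<Rightarrow> (real \<Rightarrow> 'a) topology" where
  "visual_boundary x\<^sub>0 =
    topology_generated_by {boundary_nbhd x\<^sub>0 \<alpha> R \<epsilon> | \<alpha> R \<epsilon>. \<alpha> \<in> rays x\<^sub>0 \<and> R > 0 \<and> \<epsilon> > 0}"

lemma topspace_visual_boundary: "topspace (visual_boundary x\<^sub>0) = rays x\<^sub>0"
proof -
  have "\<alpha> \<in> boundary_nbhd x\<^sub>0 \<alpha> 1 1" if "\<alpha> \<in> rays x\<^sub>0" for \<alpha>
    using that by (simp add: boundary_nbhd_def)
  moreover have "(0::real) < 1"
    by simp
  ultimately have "rays x\<^sub>0 \<subseteq>
      \<Union>{boundary_nbhd x\<^sub>0 \<alpha> R \<epsilon> | \<alpha> R \<epsilon>. \<alpha> \<in> rays x\<^sub>0 \<and> R > 0 \<and> \<epsilon> > 0}"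
    by blast
  moreover have "boundary_nbhd x\<^sub>0 \<alpha> R \<epsilon> \<subseteq> rays x\<^sub>0" for \<alpha> R \<epsilon>
    by (simp add: boundary_nbhd_def)
  ultimately have "\<Union>{boundary_nbhd x\<^sub>0 \<alpha> R \<epsilon> | \<alpha> R \<epsilon>. \<alpha> \<in> rays x\<^sub>0 \<and> R > 0 \<and> \<epsilon> > 0} = rays x\<^sub>0"
    by blast
  then show ?thesis
    by (simp add: visual_boundary_def)
qed

text \<open>
  An ultrafilter is represented by the filter \<open>\<omega>\<close> whose large sets are its members;
  the ultralimit of a sequence is then its limit along \<open>\<omega>\<close>.
\<close>

definition nonprincipal_ultrafilter :: "nat filter \<Rightarrow> bool" where
  "nonprincipal_ultrafilter \<omega> \<longleftrightarrow> \<omega> \<noteq> bot \<and>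
    (\<forall>P. eventually P \<omega> \<or> eventually (\<lambda>n. \<not> P n) \<omega>) \<and>
    (\<forall>n. \<omega> \<noteq> principal {n})"

definition scaling_sequence :: "nat filter \<Rightarrow> (nat \<Rightarrow> real) \<Rightarrow> bool" where
  "scaling_sequence \<omega> d \<longleftrightarrow> (\<forall>n. d n > 0) \<and> filterlim d at_top \<omega>"

definition cone_seqs :: "'a::metric_space \<Rightarrow> (nat \<Rightarrow> real) \<Rightarrow> (nat \<Rightarrow> 'a) set" where
  "cone_seqs x\<^sub>0 d = {x. bounded (range (\<lambda>n. dist (x n) x\<^sub>0 / d n))}"

definition cone_rel ::
  "nat filter \<Rightarrow> 'a::metric_space \<Rightarrow> (nat \<Rightarrow> real) \<Rightarrow> ((nat \<Rightarrow> 'a) \<times> (nat \<Rightarrow> 'a)) set" where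
  "cone_rel \<omega> x\<^sub>0 d = {(x, y). x \<in> cone_seqs x\<^sub>0 d \<and> y \<in> cone_seqs x\<^sub>0 d \<and>
    ((\<lambda>n. dist (x n) (y n) / d n) \<longlongrightarrow> 0) \<omega>}"

definition asymptotic_cone ::
  "nat filter \<Rightarrow> 'a::metric_space \<Rightarrow> (nat \<Rightarrow> real) \<Rightarrow> (nat \<Rightarrow> 'a) set set" where
  "asymptotic_cone \<omega> x\<^sub>0 d = cone_seqs x\<^sub>0 d // cone_rel \<omega> x\<^sub>0 d"

definition cone_point ::
  "nat filter \<Rightarrow> 'a::metric_space \<Rightarrow> (nat \<Rightarrow> real) \<Rightarrow> (nat \<Rightarrow> 'a) \<Rightarrow> (nat \<Rightarrow> 'a) set" where
  "cone_point \<omega> x\<^sub>0 d x = cone_rel \<omega> x\<^sub>0 d `` {x}"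

definition Psi_seq ::
  "nat filter \<Rightarrow> 'a::metric_space \<Rightarrow> (nat \<Rightarrow> real) \<Rightarrow> real \<Rightarrow> (nat \<Rightarrow> real \<Rightarrow> 'a) \<Rightarrow> (nat \<Rightarrow> 'a) set" where
  "Psi_seq \<omega> x\<^sub>0 d t \<beta> = cone_point \<omega> x\<^sub>0 d (\<lambda>n. \<beta> n (t * d n))"

definition Psi ::
  "nat filter \<Rightarrow> 'a::metric_space \<Rightarrow> (nat \<Rightarrow> real) \<Rightarrow> real \<Rightarrow> (real \<Rightarrow> 'a) \<Rightarrow> (nat \<Rightarrow> 'a) set" where
  "Psi \<omega> x\<^sub>0 d t \<beta> = cone_point \<omega> x\<^sub>0 d (\<lambda>n. \<beta> (t * d n))"

lemma equiv_cone_rel: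
  assumes "scaling_sequence \<omega> d"
  shows "equiv (cone_seqs x\<^sub>0 d) (cone_rel \<omega> x\<^sub>0 d)"
proof (rule equivI)
  have d: "d n > 0" for n
    using assms by (simp add: scaling_sequence_def)
  show "cone_rel \<omega> x\<^sub>0 d \<subseteq> cone_seqs x\<^sub>0 d \<times> cone_seqs x\<^sub>0 d"
    by (auto simp: cone_rel_def)
  show "refl_on (cone_seqs x\<^sub>0 d) (cone_rel \<omega> x\<^sub>0 d)"
    by (auto simp: refl_on_def cone_rel_def)
  show "sym (cone_rel \<omega> x\<^sub>0 d)"
    by (auto simp: sym_def cone_rel_def dist_commute)
  show "trans (cone_rel \<omega> x\<^sub>0 d)"
  proof (rule transI)
    fix x y z
    assume xy: "(x, y) \<in> cone_rel \<omega> x\<^sub>0 d" and yz: "(y, z) \<in> cone_rel \<omega> x\<^sub>0 d"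
    have sum: "((\<lambda>n. dist (x n) (y n) / d n + dist (y n) (z n) / d n) \<longlongrightarrow> 0) \<omega>"
      using xy yz by (auto simp: cone_rel_def intro: tendsto_add_zero)
    have "dist (x n) (z n) / d n \<le> dist (x n) (y n) / d n + dist (y n) (z n) / d n" for n
      using d[of n] dist_triangle[of "x n" "z n" "y n"]
      by (simp add: divide_right_mono flip: add_divide_distrib)
    then have "((\<lambda>n. dist (x n) (z n) / d n) \<longlongrightarrow> 0) \<omega>"
      using d by (intro tendsto_sandwich[OF _ _ tendsto_const sum]) (simp_all add: less_imp_le)
    then show "(x, z) \<in> cone_rel \<omega> x\<^sub>0 d"
      using xy yz by (auto simp: cone_rel_def)
  qed
qed

lemma Psi_seq_in_asymptotic_cone:
  assumes "scaling_sequence \<omega> d" "t \<ge> 0" "\<And>n. \<beta> n \<in> rays x\<^sub>0"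
  shows "Psi_seq \<omega> x\<^sub>0 d t \<beta> \<in> asymptotic_cone \<omega> x\<^sub>0 d"
proof -
  have "dist (\<beta> n (t * d n)) x\<^sub>0 / d n = t" for n
  proof -
    have dn: "d n > 0"
      using assms(1) by (simp add: scaling_sequence_def)
    have \<beta>: "\<beta> n 0 = x\<^sub>0" "\<And>s u. s \<ge> 0 \<Longrightarrow> u \<ge> 0 \<Longrightarrow> dist (\<beta> n s) (\<beta> n u) = \<bar>s - u\<bar>"
      using assms(3)[of n] by (auto simp: rays_def)
    have "dist (\<beta> n (t * d n)) x\<^sub>0 = t * d n"
      using \<beta>(2)[of "t * d n" 0] \<beta>(1) assms(2) dn by simp
    then show ?thesis
      using dn by simp
  qed
  then have "(\<lambda>n. \<beta> n (t * d n)) \<in> cone_seqs x\<^sub>0 d"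
    by (simp add: cone_seqs_def)
  then show ?thesis
    by (simp add: Psi_seq_def cone_point_def asymptotic_cone_def quotientI)
qed

lemma Psi_in_asymptotic_cone:
  assumes "scaling_sequence \<omega> d" "t \<ge> 0" "\<beta> \<in> rays x\<^sub>0"
  shows "Psi \<omega> x\<^sub>0 d t \<beta> \<in> asymptotic_cone \<omega> x\<^sub>0 d"
  using Psi_seq_in_asymptotic_cone[of \<omega> d t "\<lambda>_. \<beta>" x\<^sub>0] assms
  by (simp add: Psi_seq_def Psi_def)

end

theory Submission imports Defs begin

text \<open>
  Convergence in the visual boundary is pointwise convergence of rays. If \<open>\<alpha>\<^sub>n \<rightarrow> \<alpha>\<^sub>0\<close>, then
  \<open>\<alpha>\<^sub>n\<close> stays within bounded distance of \<open>\<alpha>\<^sub>0\<close> on \<open>[0, k\<^sub>n]\<close> for some \<open>k\<^sub>n \<rightarrow> \<infinity>\<close>, and the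
  scaling \<open>d\<^sub>n = sqrt (k\<^sub>n + 1)\<close> grows slowly enough that \<open>t d\<^sub>n \<le> k\<^sub>n\<close> for large \<open>n\<close>. Conversely,
  if \<open>\<alpha>\<^sub>n\<close> stays \<open>\<epsilon>\<close>-far from \<open>\<alpha>\<^sub>0\<close> at some time \<open>t\<^sub>0\<close> for infinitely many \<open>n\<close>, a bijection
  moves such indices onto an \<open>\<omega>\<close>-large set, and by CAT(0) comparison the rays diverge at least
  at linear speed \<open>\<epsilon> / t\<^sub>0\<close> there, so no scaling sequence can identify them at \<open>t = 1\<close>.
\<close>

section \<open>Rays from the basepoint and CAT(0) comparison\<close>

lemma dist_rays:
  assumes "\<alpha> \<in> rays x\<^sub>0" "s \<ge> 0" "t \<ge> 0"
  shows "dist (\<alpha> s) (\<alpha> t) = \<bar>s - t\<bar>"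
  using assms by (auto simp: rays_def)

lemma rays_0: "\<alpha> \<in> rays x\<^sub>0 \<Longrightarrow> \<alpha> 0 = x\<^sub>0"
  by (auto simp: rays_def)

lemma dist_ray_basepoint: "\<alpha> \<in> rays x\<^sub>0 \<Longrightarrow> t \<ge> 0 \<Longrightarrow> dist (\<alpha> t) x\<^sub>0 = t"
  using dist_rays[of \<alpha> x\<^sub>0 t 0] by (simp add: rays_0)

lemma geodesic_segment_ray:
  assumes "\<alpha> \<in> rays x\<^sub>0" "s \<ge> 0"
  shows "geodesic_segment x\<^sub>0 (\<alpha> s) (\<alpha> ` {0..s})"
proof -
  have "dist x\<^sub>0 (\<alpha> s) = s"
    using dist_ray_basepoint[OF assms] by (simp add: dist_commute)
  then show ?thesis
    unfolding geodesic_segment_def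
    by (intro exI[of _ \<alpha>]) (simp add: rays_0[OF assms(1)] dist_rays[OF assms(1)])
qed

text \<open>\<open>CAT0\<close> orients the sides of a triangle cyclically, so a ray out of the
  basepoint has to be reversed to serve as the third side.\<close>

lemma geodesic_segment_sym:
  assumes "geodesic_segment p q S"
  shows "geodesic_segment q p S"
proof -
  obtain c :: "real \<Rightarrow> 'a" where c: "c 0 = p" "c (dist p q) = q"
    "\<And>s t. s \<in> {0..dist p q} \<Longrightarrow> t \<in> {0..dist p q} \<Longrightarrow> dist (c s) (c t) = \<bar>s - t\<bar>"
    "S = c ` {0..dist p q}"
    using assms unfolding geodesic_segment_def by auto
  have "(\<lambda>s. dist p q - s) ` {0..dist p q} = {0..dist p q}"
    by (simp add: image_diff_atLeastAtMost)
  then have "S = (\<lambda>s. c (dist p q - s)) ` {0..dist p q}"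
    using c(4) image_image[of c "\<lambda>s. dist p q - s" "{0..dist p q}"] by simp
  then show ?thesis
    unfolding geodesic_segment_def
    using c(1-3) by (intro exI[of _ "\<lambda>s. c (dist p q - s)"]) (auto simp: dist_commute)
qed

text \<open>Compare the triangle with vertices \<open>x\<^sub>0\<close>, \<open>\<alpha> s\<close>,
  \<open>\<beta> s\<close> with a Euclidean one whose apex is the origin. The points at distance
  \<open>r\<close> from the apex correspond to the base vertices scaled by \<open>r / s\<close>, and
  similar triangles give the factor.\<close>

lemma rays_dist_le_scaled:
  fixes x\<^sub>0 :: "'a::metric_space"
  assumes "CAT0 TYPE('a)" and \<alpha>: "\<alpha> \<in> rays x\<^sub>0" and \<beta>: "\<beta> \<in> rays x\<^sub>0"
    and r: "0 \<le> r" "r \<le> s" "0 < s"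
  shows "dist (\<alpha> r) (\<beta> r) \<le> r / s * dist (\<alpha> s) (\<beta> s)"
proof -
  define l where "l = dist (\<alpha> s) (\<beta> s)"
  \<comment> \<open>The comparison triangle is isosceles with legs \<open>s\<close> and horizontal
    base \<open>l\<close> at height \<open>h\<close>; the bound \<open>l \<le> 2 * s\<close> below
    makes the radicand nonnegative.\<close>
  define h where "h = sqrt (s\<^sup>2 - (l / 2)\<^sup>2)"
  define q' :: "real^2" where "q' = vector [l / 2, h]"
  define r' :: "real^2" where "r' = vector [- l / 2, h]"
  have s0: "s \<ge> 0" using r by simp
  have "l \<le> 2 * s"
    using dist_triangle2[of "\<alpha> s" "\<beta> s" x\<^sub>0] dist_ray_basepoint[OF \<alpha> s0] dist_ray_basepoint[OF \<beta> s0]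
    unfolding l_def by simp
  moreover have "0 \<le> l" by (simp add: l_def)
  ultimately have "(l / 2)\<^sup>2 \<le> s\<^sup>2" by (intro power_mono) auto
  then have h: "h\<^sup>2 = s\<^sup>2 - (l / 2)\<^sup>2" by (simp add: h_def)
  have nq: "norm q' = s" and nr: "norm r' = s"
    using h s0 by (simp_all add: q'_def r'_def norm_vec_def L2_set_def sum_2 power_divide)
  have qr: "dist q' r' = l"
    using \<open>0 \<le> l\<close> by (simp add: q'_def r'_def dist_vec_def L2_set_def sum_2 dist_real_def)
  obtain S where S: "geodesic_segment (\<alpha> s) (\<beta> s) S"
    using assms(1) unfolding CAT0_def geodesic_space_def by blast
  have tri: "geodesic_segment x\<^sub>0 (\<alpha> s) (\<alpha> ` {0..s}) \<and> geodesic_segment (\<alpha> s) (\<beta> s) S \<and>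
      geodesic_segment (\<beta> s) x\<^sub>0 (\<beta> ` {0..s}) \<and>
      dist 0 q' = dist x\<^sub>0 (\<alpha> s) \<and> dist q' r' = dist (\<alpha> s) (\<beta> s) \<and> dist r' 0 = dist (\<beta> s) x\<^sub>0"
    using S geodesic_segment_ray[OF \<alpha> s0] geodesic_segment_sym[OF geodesic_segment_ray[OF \<beta> s0]]
      dist_ray_basepoint[OF \<alpha> s0] dist_ray_basepoint[OF \<beta> s0] nq nr qr
    by (simp add: l_def dist_commute[of x\<^sub>0])
  let ?k = "r / s"
  have k: "0 \<le> ?k" "?k \<le> 1" using r by auto
  have "comparison_point x\<^sub>0 (\<alpha> ` {0..s}) 0 q' (\<alpha> r) (?k *\<^sub>R q')"
    unfolding comparison_point_def
    using r k nq dist_ray_basepoint[OF \<alpha> r(1)]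
    by (auto simp: in_segment dist_commute[of x\<^sub>0] intro: exI[of _ ?k])
  \<comment> \<open>This side starts at \<open>\<beta> s\<close>, so the position is measured from
    there: the distance is \<open>s - r\<close> and the segment parameter is
    \<open>1 - r / s\<close>.\<close>
  moreover have "comparison_point (\<beta> s) (\<beta> ` {0..s}) r' 0 (\<beta> r) (?k *\<^sub>R r')"
  proof -
    have "r' - ?k *\<^sub>R r' = (1 - ?k) *\<^sub>R r'" by (simp add: scaleR_left_diff_distrib)
    then have "dist r' (?k *\<^sub>R r') = (1 - ?k) * s"
      using k nr by (simp add: dist_norm)
    also have "\<dots> = s - r" using r by (simp add: field_simps)
    also have "\<dots> = dist (\<beta> s) (\<beta> r)" using r by (simp add: dist_rays[OF \<beta>])
    finally show ?thesis
      unfolding comparison_point_def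
      using r k by (auto simp: in_segment intro: exI[of _ "1 - ?k"])
  qed
  ultimately have "dist (\<alpha> r) (\<beta> r) \<le> dist (?k *\<^sub>R q') (?k *\<^sub>R r')"
    using assms(1) tri unfolding CAT0_def Let_def by blast
  also have "\<dots> = ?k * l"
    using k(1) qr by (simp only: dist_norm norm_scaleR abs_of_nonneg flip: scaleR_right_diff_distrib)
  finally show ?thesis by (simp add: l_def)
qed

section \<open>Convergence in the visual boundary\<close>

lemma infdist_less_iff:
  assumes "A \<noteq> {}"
  shows "infdist x A < e \<longleftrightarrow> (\<exists>a\<in>A. dist x a < e)"
  using assms by (simp add: infdist_notempty cINF_less_iff)

text \<open>Neighbourhoods centred at the limit itself control each positive time. Conversely,
  induction over the generation of open sets reduces the claim to the generators, where convergence
  at a single time suffices.\<close>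

lemma limitin_visual_boundary_iff:
  fixes \<alpha> :: "nat \<Rightarrow> real \<Rightarrow> 'a::metric_space"
  assumes \<alpha>: "\<And>n. \<alpha> n \<in> rays x\<^sub>0" and \<alpha>\<^sub>0: "\<alpha>\<^sub>0 \<in> rays x\<^sub>0"
  shows "limitin (visual_boundary x\<^sub>0) \<alpha> \<alpha>\<^sub>0 sequentially \<longleftrightarrow>
    (\<forall>t\<ge>0. (\<lambda>n. \<alpha> n t) \<longlonglongrightarrow> \<alpha>\<^sub>0 t)"
proof
  assume lim: "limitin (visual_boundary x\<^sub>0) \<alpha> \<alpha>\<^sub>0 sequentially"
  show "\<forall>t\<ge>0. (\<lambda>n. \<alpha> n t) \<longlonglongrightarrow> \<alpha>\<^sub>0 t"
  proof (intro allI impI)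
    fix t :: real assume "t \<ge> 0"
    show "(\<lambda>n. \<alpha> n t) \<longlonglongrightarrow> \<alpha>\<^sub>0 t"
    proof (cases "t = 0")
      case True
      then show ?thesis by (simp add: rays_0[OF \<alpha>] rays_0[OF \<alpha>\<^sub>0])
    next
      case False
      with \<open>t \<ge> 0\<close> have t: "t > 0" by simp
      show ?thesis
      proof (rule tendstoI)
        fix e :: real assume e: "e > 0"
        \<comment> \<open>One half of \<open>e\<close> pays for the distance to the nearby point
          \<open>\<alpha> n s\<close>, the other for the parameter shift from \<open>s\<close> to
          \<open>t\<close>.\<close>
        have "openin (visual_boundary x\<^sub>0) (boundary_nbhd x\<^sub>0 \<alpha>\<^sub>0 t (e / 2))"
          unfolding visual_boundary_def
          by (rule topology_generated_by_Basis) (use \<alpha>\<^sub>0 t half_gt_zero[OF e] in blast)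
        moreover have "\<alpha>\<^sub>0 \<in> boundary_nbhd x\<^sub>0 \<alpha>\<^sub>0 t (e / 2)"
          using \<alpha>\<^sub>0 t e by (simp add: boundary_nbhd_def)
        ultimately have "eventually (\<lambda>n. \<alpha> n \<in> boundary_nbhd x\<^sub>0 \<alpha>\<^sub>0 t (e / 2)) sequentially"
          using lim unfolding limitin_def by blast
        then show "eventually (\<lambda>n. dist (\<alpha> n t) (\<alpha>\<^sub>0 t) < e) sequentially"
        proof (rule eventually_mono)
          fix n assume "\<alpha> n \<in> boundary_nbhd x\<^sub>0 \<alpha>\<^sub>0 t (e / 2)"
          then have "infdist (\<alpha>\<^sub>0 t) (\<alpha> n ` {0..}) < e / 2"
            by (simp add: boundary_nbhd_def)
          then obtain s where s: "s \<ge> 0" "dist (\<alpha>\<^sub>0 t) (\<alpha> n s) < e / 2"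
            by (subst (asm) infdist_less_iff) auto
          \<comment> \<open>both rays start at \<open>x\<^sub>0\<close>, so the parameters differ by at most the distance\<close>
          have "\<bar>t - s\<bar> \<le> dist (\<alpha>\<^sub>0 t) (\<alpha> n s)"
            using dist_triangle[of "\<alpha>\<^sub>0 t" x\<^sub>0 "\<alpha> n s"] dist_triangle[of "\<alpha> n s" x\<^sub>0 "\<alpha>\<^sub>0 t"]
              dist_ray_basepoint[OF \<alpha>\<^sub>0] dist_ray_basepoint[OF \<alpha>] t s(1)
            by (simp add: dist_commute)
          moreover have "dist (\<alpha> n t) (\<alpha> n s) = \<bar>t - s\<bar>"
            using t s(1) by (simp add: dist_rays[OF \<alpha>])
          ultimately show "dist (\<alpha> n t) (\<alpha>\<^sub>0 t) < e"
            using s(2) dist_triangle2[of "\<alpha> n t" "\<alpha>\<^sub>0 t" "\<alpha> n s"] by linarith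
        qed
      qed
    qed
  qed
next
  assume lim: "\<forall>t\<ge>0. (\<lambda>n. \<alpha> n t) \<longlonglongrightarrow> \<alpha>\<^sub>0 t"
  let ?B = "{boundary_nbhd x\<^sub>0 \<alpha> R \<epsilon> | \<alpha> R \<epsilon>. \<alpha> \<in> rays x\<^sub>0 \<and> R > 0 \<and> \<epsilon> > 0}"
  have "eventually (\<lambda>n. \<alpha> n \<in> U) sequentially"
    if "generate_topology_on ?B U" "\<alpha>\<^sub>0 \<in> U" for U
    using that
  proof (induction rule: generate_topology_on.induct)
    case (Basis U)
    then obtain \<beta> R \<epsilon> where U: "U = boundary_nbhd x\<^sub>0 \<beta> R \<epsilon>"
      by blast
    \<comment> \<open>The centre \<open>\<beta>\<close> may differ from
      \<open>\<alpha>\<^sub>0\<close>; a witnessing time \<open>s\<close> on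
      \<open>\<alpha>\<^sub>0\<close> stays a witness on \<open>\<alpha> n\<close> for large
      \<open>n\<close>, since the inequality is strict.\<close>
    with Basis.prems obtain s where s: "s \<ge> 0" "dist (\<beta> R) (\<alpha>\<^sub>0 s) < \<epsilon>"
      by (auto simp: boundary_nbhd_def infdist_less_iff)
    have "(\<lambda>n. dist (\<beta> R) (\<alpha> n s)) \<longlonglongrightarrow> dist (\<beta> R) (\<alpha>\<^sub>0 s)"
      using lim s(1) by (intro tendsto_intros) auto
    then have "eventually (\<lambda>n. dist (\<beta> R) (\<alpha> n s) < \<epsilon>) sequentially"
      using s(2) by (rule order_tendstoD)
    then show ?case
      unfolding U by eventually_elim (use \<alpha> s(1) in \<open>auto simp: boundary_nbhd_def infdist_less_iff\<close>)
  next
    case (UN K)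
    then obtain k where "k \<in> K" "\<alpha>\<^sub>0 \<in> k" by blast
    with UN.IH have "eventually (\<lambda>n. \<alpha> n \<in> k) sequentially" by blast
    then show ?case by eventually_elim (use \<open>k \<in> K\<close> in blast)
  qed (auto intro: eventually_conj)
  then show "limitin (visual_boundary x\<^sub>0) \<alpha> \<alpha>\<^sub>0 sequentially"
    using \<alpha>\<^sub>0 unfolding limitin_def topspace_visual_boundary
    by (simp add: visual_boundary_def openin_topology_generated_by_iff)
qed

section \<open>Equality of cone points, and ultralimits of convergent sequences\<close>

lemma Psi_seq_eq_Psi_iff:
  assumes "scaling_sequence \<omega> d" "t \<ge> 0" "\<And>n. \<beta> n \<in> rays x\<^sub>0" "\<gamma> \<in> rays x\<^sub>0"
  shows "Psi_seq \<omega> x\<^sub>0 d t \<beta> = Psi \<omega> x\<^sub>0 d t \<gamma> \<longleftrightarrow>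
    ((\<lambda>n. dist (\<beta> n (t * d n)) (\<gamma> (t * d n)) / d n) \<longlongrightarrow> 0) \<omega>"
proof -
  have d: "d n > 0" for n
    using assms(1) by (simp add: scaling_sequence_def)
  \<comment> \<open>Unit speed makes the rescaled distance constantly \<open>t\<close>, so both
    sequences represent points of the cone and equality of their classes is \<open>cone_rel\<close>
    itself.\<close>
  have "dist (\<eta> (t * d n)) x\<^sub>0 / d n = t" if "\<eta> \<in> rays x\<^sub>0" for \<eta> n
    using dist_ray_basepoint[OF that, of "t * d n"] assms(2) d[of n] by simp
  then have mem: "(\<lambda>n. \<beta> n (t * d n)) \<in> cone_seqs x\<^sub>0 d" "(\<lambda>n. \<gamma> (t * d n)) \<in> cone_seqs x\<^sub>0 d"
    using assms(3,4) by (simp_all add: cone_seqs_def)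
  then show ?thesis
    unfolding Psi_seq_def Psi_def cone_point_def
    using eq_equiv_class_iff[OF equiv_cone_rel[OF assms(1), of x\<^sub>0] mem]
    by (simp add: cone_rel_def)
qed

text \<open>A large singleton would make the ultrafilter principal, so every cofinite set is large.
  Hence ordinary limits are also ultralimits.\<close>

lemma nonprincipal_ultrafilter_le_sequentially:
  assumes "nonprincipal_ultrafilter \<omega>"
  shows "\<omega> \<le> sequentially"
proof -
  have "eventually (\<lambda>m. m \<noteq> n) \<omega>" for n
  proof (rule ccontr)
    assume "\<not> ?thesis"
    then have n: "eventually (\<lambda>m. m = n) \<omega>"
      using assms unfolding nonprincipal_ultrafilter_def by fastforce
    have "eventually P \<omega> \<longleftrightarrow> P n" for P
    proof
      assume "eventually P \<omega>"
      with n have "eventually (\<lambda>_. P n) \<omega>" by eventually_elim simp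
      then show "P n"
        using assms by (simp add: nonprincipal_ultrafilter_def eventually_const_iff)
    next
      assume "P n"
      with n show "eventually P \<omega>" by (auto elim: eventually_mono)
    qed
    then have "\<omega> = principal {n}"
      by (simp add: filter_eq_iff eventually_principal)
    then show False
      using assms by (simp add: nonprincipal_ultrafilter_def)
  qed
  then have "eventually (\<lambda>m. \<forall>n\<in>{..<N}. m \<noteq> n) \<omega>" for N
    by (intro eventually_ball_finite) auto
  then have "eventually (\<lambda>m. N \<le> m) \<omega>" for N
    by (rule eventually_mono[of "\<lambda>m. \<forall>n\<in>{..<N}. m \<noteq> n"]) (auto simp: not_less[symmetric])
  then show ?thesis
    unfolding le_sequentially by blast
qed

section \<open>Reindexing by bijections of the natural numbers\<close>

lemma filterlim_sequentially_inj:
  fixes f :: "nat \<Rightarrow> nat"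
  assumes "inj f"
  shows "filterlim f sequentially sequentially"
  unfolding filterlim_iff cofinite_eq_sequentially[symmetric] eventually_cofinite
proof (intro allI impI)
  fix P :: "nat \<Rightarrow> bool" assume "finite {n. \<not> P n}"
  from finite_vimageI[OF this assms] show "finite {n. \<not> P (f n)}" by simp
qed

text \<open>Glue a bijection between the two sets to one between their complements; all four sets
  are countably infinite.\<close>

lemma exists_bij_image_eq:
  fixes A B :: "nat set"
  assumes "infinite A" "infinite (- A)" "infinite B" "infinite (- B)"
  obtains \<sigma> where "bij \<sigma>" "\<sigma> ` A = B"
proof -
  have ex: "\<exists>f. bij_betw f C D" if "infinite C" "infinite D" for C D :: "nat set"
    using bij_betw_trans[OF bij_betw_inv_into[OF bij_enumerate[OF that(1)]] bij_enumerate[OF that(2)]]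
    by blast
  from ex[OF assms(1,3)] obtain f where f: "bij_betw f A B" by blast
  from ex[OF assms(2,4)] obtain g where g: "bij_betw g (- A) (- B)" by blast
  let ?h = "\<lambda>x. if x \<in> A then f x else g x"
  have h: "bij_betw ?h A B"
    using f by (subst bij_betw_cong[where g = f]) auto
  moreover have "bij_betw ?h (- A) (- B)"
    using g by (subst bij_betw_cong[where g = g]) auto
  ultimately have "bij_betw ?h (A \<union> - A) (B \<union> - B)"
    by (rule bij_betw_combine) auto
  then show ?thesis
    using that[of ?h] bij_betw_imp_surj_on[OF h] by (simp only: Compl_partition)
qed

lemma infinite_even_odd: "infinite {n::nat. even n}" "infinite {n::nat. odd n}"
  unfolding infinite_nat_iff_unbounded_le
  by (metis mem_Collect_eq even_Suc le_Suc_eq nle_le)+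

text \<open>Take every second element in the increasing enumeration of \<open>A\<close>; the skipped
  elements keep the complement infinite.\<close>

lemma infinite_coinfinite_subset:
  fixes A :: "nat set"
  assumes "infinite A"
  obtains B where "B \<subseteq> A" "infinite B" "infinite (- B)"
proof -
  let ?e = "enumerate A"
  have inj: "inj ?e" and ran: "range ?e = A"
    using bij_enumerate[OF assms] by (simp_all add: bij_betw_def)
  have "infinite (?e ` {n. even n})" "infinite (?e ` {n. odd n})"
    using infinite_even_odd inj by (simp_all add: finite_image_iff inj_on_subset)
  moreover have "?e ` {n. odd n} \<subseteq> - (?e ` {n. even n})"
    using inj by (auto dest: injD)
  ultimately show ?thesis
    using that[of "?e ` {n. even n}"] ran infinite_super by blast
qed

text \<open>The evens or the odds are large, and both have infinite complement. As \<open>A\<close>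
  may be cofinite, it is first thinned to a coinfinite \<open>B\<close>, onto which a bijection
  carries the large class.\<close>

lemma exists_bij_eventually_in:
  assumes "nonprincipal_ultrafilter \<omega>" "infinite A"
  obtains \<sigma> :: "nat \<Rightarrow> nat" where "bij \<sigma>" "eventually (\<lambda>n. \<sigma> n \<in> A) \<omega>"
proof -
  obtain C where C: "infinite C" "infinite (- C)" "eventually (\<lambda>n::nat. n \<in> C) \<omega>"
  proof (cases "eventually (\<lambda>n::nat. even n) \<omega>")
    case True
    then show thesis
      using that[of "{n. even n}"] infinite_even_odd by (simp add: Collect_neg_eq)
  next
    case False
    then have "eventually (\<lambda>n::nat. odd n) \<omega>"
      using assms(1) by (auto simp: nonprincipal_ultrafilter_def)
    then show thesis
      using that[of "{n. odd n}"] infinite_even_odd by (simp add: Collect_neg_eq)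
  qed
  obtain B where B: "B \<subseteq> A" "infinite B" "infinite (- B)"
    using infinite_coinfinite_subset[OF assms(2)] .
  obtain \<sigma> where \<sigma>: "bij \<sigma>" "\<sigma> ` C = B"
    using exists_bij_image_eq[OF C(1,2) B(2,3)] .
  have "eventually (\<lambda>n. \<sigma> n \<in> A) \<omega>"
    using C(3) by (rule eventually_mono) (use \<sigma>(2) B(1) in blast)
  with \<sigma>(1) show ?thesis by (rule that)
qed

section \<open>A scaling sequence that grows slowly enough\<close>

lemma exists_slow_index:
  fixes P :: "nat \<Rightarrow> nat \<Rightarrow> bool"
  assumes "\<And>n. P n 0" "\<And>k. eventually (\<lambda>n. P n k) sequentially"
  obtains k :: "nat \<Rightarrow> nat" where "filterlim k at_top sequentially" "\<And>n j. j \<le> k n \<Longrightarrow> P n j"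
proof -
  \<comment> \<open>A diagonal choice: \<open>k n\<close> will be the largest element of
    \<open>K n\<close>. The cap \<open>k \<le> n\<close> keeps \<open>K n\<close> finite, and
    \<open>P n 0\<close> keeps it nonempty.\<close>
  define K where "K n = {k. k \<le> n \<and> (\<forall>j\<le>k. P n j)}" for n
  have fin: "finite (K n)" for n
    by (rule finite_subset[of _ "{..n}"]) (auto simp: K_def)
  have "0 \<in> K n" for n
    using assms(1) by (simp add: K_def)
  then have "Max (K n) \<in> K n" for n
    using fin by (intro Max_in) auto
  then have "P n j" if "j \<le> Max (K n)" for n j
    using that unfolding K_def by blast
  moreover have "filterlim (\<lambda>n. Max (K n)) at_top sequentially"
    unfolding filterlim_at_top
  proof
    fix Z
    have "eventually (\<lambda>n. \<forall>j\<in>{..Z}. P n j) sequentially"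
      using assms(2) by (intro eventually_ball_finite) auto
    with eventually_ge_at_top[of Z] show "eventually (\<lambda>n. Z \<le> Max (K n)) sequentially"
    proof eventually_elim
      case (elim n)
      then have "Z \<in> K n" by (simp add: K_def)
      then show ?case by (rule Max_ge[OF fin])
    qed
  qed
  ultimately show ?thesis
    using that by blast
qed

lemma exists_scaling_sequence:
  assumes "nonprincipal_ultrafilter \<omega>" and \<beta>: "\<And>n. \<beta> n \<in> rays x\<^sub>0" and \<gamma>: "\<gamma> \<in> rays x\<^sub>0"
    and lim: "\<And>t. t \<ge> 0 \<Longrightarrow> (\<lambda>n. \<beta> n t) \<longlonglongrightarrow> \<gamma> t"
  shows "\<exists>d. scaling_sequence \<omega> d \<and>
    (\<forall>t\<ge>0. ((\<lambda>n. dist (\<beta> n (t * d n)) (\<gamma> (t * d n)) / d n) \<longlongrightarrow> 0) \<omega>)"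
proof -
  \<comment> \<open>Testing integer times only leaves countably many conditions; the one at time 0
    holds for every \<open>n\<close> because the rays share their origin.\<close>
  have "eventually (\<lambda>n. dist (\<beta> n (real k)) (\<gamma> (real k)) \<le> 1) sequentially" for k
    using tendstoD[OF lim[of "real k"], of 1] by (auto elim: eventually_mono)
  then obtain k :: "nat \<Rightarrow> nat" where k: "filterlim k at_top sequentially"
    and near: "\<And>n j. j \<le> k n \<Longrightarrow> dist (\<beta> n (real j)) (\<gamma> (real j)) \<le> 1"
    using exists_slow_index[of "\<lambda>n j. dist (\<beta> n (real j)) (\<gamma> (real j)) \<le> 1"]
    by (auto simp: rays_0[OF \<beta>] rays_0[OF \<gamma>])
  \<comment> \<open>The 3 is 1 at the integer time \<open>j\<close> just below \<open>s\<close>,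
    plus at most 1 on each ray for moving between \<open>s\<close> and \<open>j\<close>.\<close>
  have bound: "dist (\<beta> n s) (\<gamma> s) \<le> 3" if s: "0 \<le> s" "s \<le> real (k n)" for n s
  proof -
    define j where "j = nat \<lfloor>s\<rfloor>"
    have j: "real j \<le> s" "s \<le> real j + 1" "j \<le> k n"
      using s unfolding j_def by linarith+
    have "dist (\<beta> n s) (\<gamma> s) \<le> dist (\<beta> n s) (\<beta> n j) + dist (\<beta> n j) (\<gamma> j) + dist (\<gamma> j) (\<gamma> s)"
      using dist_triangle[of "\<beta> n s" "\<gamma> s" "\<beta> n j"] dist_triangle[of "\<beta> n j" "\<gamma> s" "\<gamma> j"] by linarith
    moreover have "dist (\<beta> n s) (\<beta> n j) \<le> 1" "dist (\<gamma> j) (\<gamma> s) \<le> 1"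
      using s j by (simp_all add: dist_rays[OF \<beta>] dist_rays[OF \<gamma>])
    ultimately show ?thesis
      using near[OF j(3)] by linarith
  qed
  \<comment> \<open>Adding 1 under the root keeps \<open>d n\<close> positive when
    \<open>k n = 0\<close>.\<close>
  define d where "d n = sqrt (real (k n) + 1)" for n
  have kreal: "filterlim (\<lambda>n. real (k n)) at_top sequentially"
    using filterlim_compose[OF filterlim_real_sequentially k] .
  have dlim: "filterlim d at_top sequentially"
    unfolding d_def
    by (intro filterlim_compose[OF sqrt_at_top] filterlim_at_top_mono[OF kreal]) auto
  have \<omega>: "\<omega> \<le> sequentially"
    by (rule nonprincipal_ultrafilter_le_sequentially[OF assms(1)])
  have dpos: "d n > 0" for n
    by (simp add: d_def add_nonneg_pos)
  have "((\<lambda>n. dist (\<beta> n (t * d n)) (\<gamma> (t * d n)) / d n) \<longlongrightarrow> 0) sequentially" if t: "t \<ge> 0" for t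
  proof (rule tendsto_sandwich[of "\<lambda>_. 0" _ _ "\<lambda>n. 3 / d n"])
    show "eventually (\<lambda>n. dist (\<beta> n (t * d n)) (\<gamma> (t * d n)) / d n \<le> 3 / d n) sequentially"
      using eventually_compose_filterlim[OF eventually_ge_at_top[of "t + 1"] dlim]
    proof (rule eventually_mono)
      fix n assume n: "t + 1 \<le> d n"
      \<comment> \<open>Since \<open>d n\<close> squared is \<open>k n + 1\<close>, this gives
        \<open>t * d n + d n \<le> k n + 1\<close>, and \<open>d n \<ge> 1\<close> absorbs the extra
        1.\<close>
      have "(t + 1) * d n \<le> d n * d n"
        using n dpos[of n] by (intro mult_right_mono) auto
      moreover have "d n * d n = real (k n) + 1"
        by (simp add: d_def)
      ultimately have "t * d n \<le> real (k n)"
        using n t by (simp add: algebra_simps)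
      then show "dist (\<beta> n (t * d n)) (\<gamma> (t * d n)) / d n \<le> 3 / d n"
        using bound[of "t * d n" n] t dpos[of n] by (intro divide_right_mono) auto
    qed
    show "(\<lambda>n. 3 / d n) \<longlonglongrightarrow> 0"
      using dlim by (intro tendsto_divide_0[OF tendsto_const] filterlim_at_top_imp_at_infinity)
  qed (use dpos in \<open>auto simp: less_imp_le\<close>)
  then show ?thesis
    using dpos filterlim_mono[OF dlim order_refl \<omega>] tendsto_mono[OF \<omega>]
    unfolding scaling_sequence_def by blast
qed

theorem theorem3:
  fixes x\<^sub>0 :: "'a::metric_space"
    and \<omega> :: "nat filter"
    and \<alpha> :: "nat \<Rightarrow> real \<Rightarrow> 'a"
    and \<alpha>\<^sub>0 :: "real \<Rightarrow> 'a"
  assumes "proper TYPE('a)"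
    and "CAT0 TYPE('a)"
    and "nonprincipal_ultrafilter \<omega>"
    and "\<And>n. \<alpha> n \<in> rays x\<^sub>0"
    and "\<alpha>\<^sub>0 \<in> rays x\<^sub>0"
  shows "limitin (visual_boundary x\<^sub>0) \<alpha> \<alpha>\<^sub>0 sequentially \<longleftrightarrow>
    (\<forall>\<sigma>::nat \<Rightarrow> nat. bij \<sigma> \<longrightarrow>
      (\<exists>d. scaling_sequence \<omega> d \<and>
        (\<forall>t\<ge>0. Psi_seq \<omega> x\<^sub>0 d t (\<lambda>n. \<alpha> (\<sigma> n)) = Psi \<omega> x\<^sub>0 d t \<alpha>\<^sub>0)))"
  unfolding limitin_visual_boundary_iff[OF assms(4,5)]
proof (intro iffI allI impI)
  fix \<sigma> :: "nat \<Rightarrow> nat"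
  assume lim: "\<forall>t\<ge>0. (\<lambda>n. \<alpha> n t) \<longlonglongrightarrow> \<alpha>\<^sub>0 t" and "bij \<sigma>"
  have "filterlim \<sigma> sequentially sequentially"
    by (rule filterlim_sequentially_inj[OF bij_is_inj[OF \<open>bij \<sigma>\<close>]])
  then have "(\<lambda>n. \<alpha> (\<sigma> n) t) \<longlonglongrightarrow> \<alpha>\<^sub>0 t" if "t \<ge> 0" for t
    using lim that filterlim_compose by blast
  then obtain d where d: "scaling_sequence \<omega> d"
    "\<And>t. t \<ge> 0 \<Longrightarrow> ((\<lambda>n. dist (\<alpha> (\<sigma> n) (t * d n)) (\<alpha>\<^sub>0 (t * d n)) / d n) \<longlongrightarrow> 0) \<omega>"
    using exists_scaling_sequence[of \<omega> "\<lambda>n. \<alpha> (\<sigma> n)" x\<^sub>0 \<alpha>\<^sub>0] assms(3-5) by auto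
  then show "\<exists>d. scaling_sequence \<omega> d \<and>
      (\<forall>t\<ge>0. Psi_seq \<omega> x\<^sub>0 d t (\<lambda>n. \<alpha> (\<sigma> n)) = Psi \<omega> x\<^sub>0 d t \<alpha>\<^sub>0)"
    using Psi_seq_eq_Psi_iff[OF d(1) _ _ assms(5), of _ "\<lambda>n. \<alpha> (\<sigma> n)"] assms(4) by blast
next
  fix t :: real
  assume cone: "\<forall>\<sigma>::nat \<Rightarrow> nat. bij \<sigma> \<longrightarrow> (\<exists>d. scaling_sequence \<omega> d \<and>
      (\<forall>t\<ge>0. Psi_seq \<omega> x\<^sub>0 d t (\<lambda>n. \<alpha> (\<sigma> n)) = Psi \<omega> x\<^sub>0 d t \<alpha>\<^sub>0))" and "t \<ge> 0"
  show "(\<lambda>n. \<alpha> n t) \<longlonglongrightarrow> \<alpha>\<^sub>0 t"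
  proof (rule ccontr)
    assume not: "\<not> ?thesis"
    then have "t \<noteq> 0"
      by (auto simp: rays_0[OF assms(4)] rays_0[OF assms(5)])
    with \<open>t \<ge> 0\<close> have t: "t > 0" by simp
    from not obtain e where e: "e > 0"
      and "\<not> eventually (\<lambda>n. dist (\<alpha> n t) (\<alpha>\<^sub>0 t) < e) sequentially"
      unfolding tendsto_iff by blast
    \<comment> \<open>\<open>sequentially\<close> is the cofinite filter, so failing to hold
      eventually means having infinitely many exceptions.\<close>
    then have "infinite {n. dist (\<alpha> n t) (\<alpha>\<^sub>0 t) \<ge> e}"
      by (simp add: not_eventually not_less flip: cofinite_eq_sequentially frequently_cofinite)
    from exists_bij_eventually_in[OF assms(3) this] obtain \<sigma>
      where \<sigma>: "bij \<sigma>" "eventually (\<lambda>n. dist (\<alpha> (\<sigma> n) t) (\<alpha>\<^sub>0 t) \<ge> e) \<omega>"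
      by auto
    from cone \<sigma>(1) obtain d where d: "scaling_sequence \<omega> d"
      "Psi_seq \<omega> x\<^sub>0 d 1 (\<lambda>n. \<alpha> (\<sigma> n)) = Psi \<omega> x\<^sub>0 d 1 \<alpha>\<^sub>0"
      by force
    have "((\<lambda>n. dist (\<alpha> (\<sigma> n) (d n)) (\<alpha>\<^sub>0 (d n)) / d n) \<longlongrightarrow> 0) \<omega>"
      using Psi_seq_eq_Psi_iff[OF d(1) _ _ assms(5), of 1 "\<lambda>n. \<alpha> (\<sigma> n)"] assms(4) d(2) by simp
    then have "eventually (\<lambda>n. dist (\<alpha> (\<sigma> n) (d n)) (\<alpha>\<^sub>0 (d n)) / d n < e / t) \<omega>"
      using e t by (intro order_tendstoD) auto
    moreover have "eventually (\<lambda>n. t \<le> d n) \<omega>"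
      using d(1) by (simp add: scaling_sequence_def filterlim_at_top)
    \<comment> \<open>At such an index, contraction from time \<open>d n\<close> back to
      \<open>t\<close> gives \<open>e \<le> t * (dist (\<alpha> (\<sigma> n) (d n))
      (\<alpha>\<^sub>0 (d n)) / d n)\<close>, which is less than
      \<open>t * (e / t) = e\<close>.\<close>
    ultimately have "eventually (\<lambda>n. False) \<omega>"
      using \<sigma>(2)
    proof eventually_elim
      case (elim n)
      have "e \<le> t / d n * dist (\<alpha> (\<sigma> n) (d n)) (\<alpha>\<^sub>0 (d n))"
        using rays_dist_le_scaled[OF assms(2) assms(4)[of "\<sigma> n"] assms(5), of t "d n"] elim t by simp
      then show False
        using elim t by (simp add: field_simps)
    qed
    then show False
      using assms(3) by (simp add: nonprincipal_ultrafilter_def)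
  qed
qed

end
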